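(* Let $\mathcal{R}=\{(r,t)\mid r>0,\ t\in\mathbb{R}\}$, and let $ds_1^2=dr^2+r^2\,dt^2$ and $ds_2^2=dr^2+\frac{1}{r^2}\,dt^2$ be Riemannian metrics on $\mathcal{R}$. Then the holomorphic sectional curvature of $\mathcal{R}$ with respect to $ds_1^2$ is $0$ at every point, and the holomorphic sectional curvature of $\mathcal{R}$ with respect to $ds_2^2$ at the point $(r,t)$ is $-2/r^2$.
   Context: Both metrics are of the form $g_h=dr^2+\frac{1}{h^2(r)}dt^2$, with $h(r)=1/r$ for $ds_1^2$ and $h(r)=r$ for $ds_2^2$. The complex structure $J_h$ is given by $J_h\partial_r=T_h$, $J_hT_h=-\partial_r$, with $T_h=h(r)\partial_t$. Since $\mathcal{R}$ has real dimension two, the holomorphic sectional curvature at a point is the sectional (Gaussian) curvature of the tangent plane spanned by $\partial_r$ and $T_h=J_h\partial_r$, with the usual sign convention (the round sphere has positive curvature). *)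

theory Defs
  imports "HOL-Analysis.Analysis"
begin

text \<open>
  Riemannian metrics on an open subset of \<open>real ^ 'n\<close> are given by their component matrices
  \<open>g p $ i $ j = g\<^sub>p(\<partial>\<^sub>i, \<partial>\<^sub>j)\<close> in the standard global coordinates, and tangent vectors at \<open>p\<close> by
  their components with respect to the coordinate frame \<open>\<partial>\<^sub>i = axis i 1\<close>. All notions below are
  local: at a point of an open set they depend only on the values of the metric on that set.
\<close>

definition partial_deriv :: "'n \<Rightarrow> (real ^ 'n \<Rightarrow> real) \<Rightarrow> real ^ 'n \<Rightarrow> real" where
  "partial_deriv i f p = deriv (\<lambda>s. f (p + s *\<^sub>R axis i 1)) 0"

definition metric_inner :: "(real ^ 'n \<Rightarrow> real ^ 'n ^ 'n) \<Rightarrow> real ^ 'n \<Rightarrow> real ^ 'n \<Rightarrow> real ^ 'n \<Rightarrow> real"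
  where "metric_inner g p u v = u \<bullet> (g p *v v)"

text \<open>
  Christoffel symbols of the Levi-Civita connection:
  \<open>\<nabla>\<close> of \<open>\<partial>\<^sub>j\<close> along \<open>\<partial>\<^sub>i\<close> is \<open>\<Sum>k. christoffel g k i j p * \<partial>\<^sub>k\<close>.
\<close>

definition christoffel ::
  "(real ^ 'n \<Rightarrow> real ^ 'n ^ 'n) \<Rightarrow> 'n \<Rightarrow> 'n \<Rightarrow> 'n \<Rightarrow> real ^ 'n \<Rightarrow> real" where
  "christoffel g k i j p =
     (1 / 2) * (\<Sum>l\<in>UNIV. matrix_inv (g p) $ k $ l *
       (partial_deriv i (\<lambda>q. g q $ j $ l) p
        + partial_deriv j (\<lambda>q. g q $ i $ l) p
        - partial_deriv l (\<lambda>q. g q $ i $ j) p))"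

text \<open>
  Components of \<open>R(X,Y)Z = \<nabla>\<^sub>X \<nabla>\<^sub>Y Z - \<nabla>\<^sub>Y \<nabla>\<^sub>X Z - \<nabla>\<^bsub>[X,Y]\<^esub> Z\<close>:
  \<open>R(\<partial>\<^sub>i, \<partial>\<^sub>j) \<partial>\<^sub>k = \<Sum>l. curvature_coeff g l i j k p * \<partial>\<^sub>l\<close>.
\<close>

definition curvature_coeff ::
  "(real ^ 'n \<Rightarrow> real ^ 'n ^ 'n) \<Rightarrow> 'n \<Rightarrow> 'n \<Rightarrow> 'n \<Rightarrow> 'n \<Rightarrow> real ^ 'n \<Rightarrow> real" where
  "curvature_coeff g l i j k p =
     partial_deriv i (christoffel g l j k) p - partial_deriv j (christoffel g l i k) p
     + (\<Sum>m\<in>UNIV. christoffel g l i m p * christoffel g m j k p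
                - christoffel g l j m p * christoffel g m i k p)"

definition curvature_tensor ::
  "(real ^ 'n \<Rightarrow> real ^ 'n ^ 'n) \<Rightarrow> real ^ 'n \<Rightarrow> real ^ 'n \<Rightarrow> real ^ 'n \<Rightarrow> real ^ 'n \<Rightarrow> real ^ 'n" where
  "curvature_tensor g p u v w =
     (\<chi> l. \<Sum>i\<in>UNIV. \<Sum>j\<in>UNIV. \<Sum>k\<in>UNIV. curvature_coeff g l i j k p * u $ i * v $ j * w $ k)"

text \<open>
  The sectional curvature of the plane spanned by \<open>u\<close> and \<open>v\<close>, for linearly independent \<open>u\<close> and
  \<open>v\<close>. With the sign of \<open>R\<close> above, the round sphere has positive curvature.
\<close>

definition sectional_curvature ::
  "(real ^ 'n \<Rightarrow> real ^ 'n ^ 'n) \<Rightarrow> real ^ 'n \<Rightarrow> real ^ 'n \<Rightarrow> real ^ 'n \<Rightarrow> real" where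
  "sectional_curvature g p u v =
     metric_inner g p (curvature_tensor g p u v v) u /
     (metric_inner g p u u * metric_inner g p v v - (metric_inner g p u v)\<^sup>2)"

definition holomorphic_sectional_curvature ::
  "(real ^ 'n \<Rightarrow> real ^ 'n ^ 'n) \<Rightarrow> (real ^ 'n \<Rightarrow> real ^ 'n \<Rightarrow> real ^ 'n) \<Rightarrow>
   real ^ 'n \<Rightarrow> real ^ 'n \<Rightarrow> real" where
  "holomorphic_sectional_curvature g J p X = sectional_curvature g p X (J p X)"

text \<open>The coordinates of a point \<open>p\<close> of the half-plane are \<open>r = p $ 1\<close> and \<open>t = p $ 2\<close>.\<close>

definition half_plane :: "(real ^ 2) set" where
  "half_plane = {p. p $ 1 > 0}"

definition ds1 :: "real ^ 2 \<Rightarrow> real ^ 2 ^ 2" where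
  "ds1 p = vector [vector [1, 0], vector [0, (p $ 1)\<^sup>2]]"

definition ds2 :: "real ^ 2 \<Rightarrow> real ^ 2 ^ 2" where
  "ds2 p = vector [vector [1, 0], vector [0, 1 / (p $ 1)\<^sup>2]]"

definition metric_h :: "(real \<Rightarrow> real) \<Rightarrow> real ^ 2 \<Rightarrow> real ^ 2 ^ 2" where
  "metric_h h p = vector [vector [1, 0], vector [0, 1 / (h (p $ 1))\<^sup>2]]"

definition T_h :: "(real \<Rightarrow> real) \<Rightarrow> real ^ 2 \<Rightarrow> real ^ 2" where
  "T_h h p = h (p $ 1) *\<^sub>R axis 2 1"

text \<open>
  The linear extension of \<open>J \<partial>\<^sub>r = T_h\<close>, \<open>J T_h = - \<partial>\<^sub>r\<close>, using \<open>\<partial>\<^sub>t = (1 / h) T_h\<close>; it is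
  meaningful where \<open>h\<close> does not vanish.
\<close>

definition J_h :: "(real \<Rightarrow> real) \<Rightarrow> real ^ 2 \<Rightarrow> real ^ 2 \<Rightarrow> real ^ 2" where
  "J_h h p v = (v $ 1) *\<^sub>R T_h h p - (v $ 2 / h (p $ 1)) *\<^sub>R axis 1 1"

lemma ds1_eq_metric_h: "ds1 = metric_h (\<lambda>r. 1 / r)"
  by (simp add: fun_eq_iff ds1_def metric_h_def power_one_over)

lemma ds2_eq_metric_h: "ds2 = metric_h (\<lambda>r. r)"
  by (simp add: fun_eq_iff ds2_def metric_h_def)

lemma linear_J_h: "linear (J_h h p)"
  by (rule linearI) (simp_all add: J_h_def algebra_simps add_divide_distrib)

lemma J_h_frame:
  assumes "h (p $ 1) \<noteq> 0"
  shows "J_h h p (axis 1 1) = T_h h p" "J_h h p (T_h h p) = - axis 1 1"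
  using assms by (simp_all add: J_h_def T_h_def vec_eq_iff forall_2 axis_def)

lemma metric_inner_metric_h:
  "metric_inner (metric_h h) p u v = u $ 1 * v $ 1 + u $ 2 * v $ 2 / (h (p $ 1))\<^sup>2"
  by (simp add: metric_inner_def metric_h_def inner_vec_def matrix_vector_mult_def UNIV_2)

lemma metric_h_pos_def:
  assumes "h (p $ 1) \<noteq> 0" "u \<noteq> 0"
  shows "metric_inner (metric_h h) p u u > 0"
proof -
  have "u $ 1 \<noteq> 0 \<or> u $ 2 / h (p $ 1) \<noteq> 0"
    using assms by (auto simp: vec_eq_iff forall_2)
  then have "(u $ 1)\<^sup>2 + (u $ 2 / h (p $ 1))\<^sup>2 > 0"
    by (simp add: sum_power2_gt_zero_iff)
  then show ?thesis
    by (simp add: metric_inner_metric_h power2_eq_square)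
qed

lemma J_h_orthogonal:
  assumes "h (p $ 1) \<noteq> 0"
  shows "metric_inner (metric_h h) p (J_h h p u) (J_h h p v) = metric_inner (metric_h h) p u v"
  using assms
  by (simp add: metric_inner_metric_h J_h_def T_h_def axis_def power2_eq_square)

end

theory Submission
  imports Defs
begin

text \<open>
  Both metrics are \<open>dr\<^sup>2 + f(r)\<^sup>2 dt\<^sup>2\<close> with \<open>f = 1/h\<close>, a surface metric written along unit speed
  geodesics orthogonal to the curves of constant \<open>r\<close>. Its Gaussian curvature is \<open>- f''/f\<close>, which in
  terms of \<open>h\<close> reads \<open>K = (h h'' - 2 h'\<^sup>2) / h\<^sup>2\<close>; it is \<open>0\<close> for \<open>h = 1/r\<close> and \<open>- 2/r\<^sup>2\<close> for
  \<open>h = r\<close>.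

  The formula is obtained from the Christoffel symbols. Since the metric is diagonal and depends
  on \<open>r\<close> only, the nonzero ones are \<open>\<Gamma>\<^sup>r\<^sub>t\<^sub>t = h'/h\<^sup>3\<close> and \<open>\<Gamma>\<^sup>t\<^sub>r\<^sub>t = \<Gamma>\<^sup>t\<^sub>t\<^sub>r = - h'/h\<close>
  (\<open>christoffel_metric_h\<close>). They give \<open>R(\<partial>\<^sub>r, \<partial>\<^sub>t) \<partial>\<^sub>t = (K/h\<^sup>2) \<partial>\<^sub>r\<close> and
  \<open>R(\<partial>\<^sub>r, \<partial>\<^sub>t) \<partial>\<^sub>r = - K \<partial>\<^sub>t\<close> (\<open>curvature_coeff_metric_h\<close>), so that both the numerator
  and the denominator of the sectional curvature of \<open>u\<close>, \<open>v\<close> are multiples of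
  \<open>(u\<^sub>r v\<^sub>t - u\<^sub>t v\<^sub>r)\<^sup>2\<close> and their quotient is \<open>K\<close> (\<open>sectional_curvature_metric_h\<close>).
  For \<open>v = J u\<close> with \<open>u \<noteq> 0\<close> this determinant does not vanish, because \<open>J u\<close> is orthogonal to
  \<open>u\<close> and of the same length.
\<close>

text \<open>
  Agreement with a function of \<open>r\<close> is only asked for near \<open>p\<close>: the metric and its
  Christoffel symbols are under control only where \<open>h\<close> does not vanish.
\<close>

lemma partial_deriv_first_coordinate:
  fixes f :: "real ^ 2 \<Rightarrow> real"
  assumes S: "open S" "p $ 1 \<in> S"
    and f: "\<And>q. q $ 1 \<in> S \<Longrightarrow> f q = \<phi> (q $ 1)"
    and \<phi>: "(\<phi> has_real_derivative D) (at (p $ 1))"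
  shows "partial_deriv i f p = (if i = 1 then D else 0)"
proof -
  let ?c = "axis i (1::real) $ 1"
  have "((\<lambda>s. \<phi> (p $ 1 + s * ?c)) has_real_derivative D * ?c) (at 0)"
    by (rule DERIV_chain2) (auto intro!: derivative_eq_intros simp: \<phi>)
  moreover have "\<forall>\<^sub>F s in nhds 0. \<phi> (p $ 1 + s * ?c) = f (p + s *\<^sub>R axis i 1)"
  proof -
    have "((\<lambda>s. p $ 1 + s * ?c) \<longlongrightarrow> p $ 1 + 0 * ?c) (nhds 0)"
      by (intro tendsto_intros) (rule filterlim_ident)
    then have "\<forall>\<^sub>F s in nhds 0. p $ 1 + s * ?c \<in> S"
      using S by (simp add: topological_tendstoD)
    then show ?thesis
      by eventually_elim (simp add: f)
  qed
  ultimately have "((\<lambda>s. f (p + s *\<^sub>R axis i 1)) has_real_derivative D * ?c) (at 0)"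
    by (simp add: DERIV_cong_ev)
  then show ?thesis
    unfolding partial_deriv_def by (simp add: DERIV_imp_deriv axis_def)
qed

lemma matrix_inv_metric_h:
  assumes "h (p $ 1) \<noteq> 0"
  shows "matrix_inv (metric_h h p) = vector [vector [1, 0], vector [0, (h (p $ 1))\<^sup>2]]"
    (is "_ = ?B")
proof -
  have AB: "metric_h h p ** ?B = mat 1" and BA: "?B ** metric_h h p = mat 1"
    using assms
    by (simp_all add: metric_h_def matrix_matrix_mult_def mat_def vec_eq_iff forall_2 UNIV_2)
  then have "matrix_inv (metric_h h p) ** metric_h h p = mat 1"
    unfolding matrix_inv_def by - (rule someI2[of _ ?B], auto)
  then have "matrix_inv (metric_h h p) ** (metric_h h p ** ?B) = ?B"
    by (simp add: matrix_mul_assoc)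
  then show ?thesis
    by (simp add: AB)
qed

locale nonvanishing_warping =
  fixes S :: "real set" and h h' h'' :: "real \<Rightarrow> real"
  assumes open_S: "open S"
    and h_nonzero: "\<And>r. r \<in> S \<Longrightarrow> h r \<noteq> 0"
    and h_deriv: "\<And>r. r \<in> S \<Longrightarrow> (h has_real_derivative h' r) (at r)"
    and h'_deriv: "\<And>r. r \<in> S \<Longrightarrow> (h' has_real_derivative h'' r) (at r)"
begin

text \<open>This is \<open>- f''/f\<close> for \<open>f = 1/h\<close>.\<close>

definition gauss_curvature :: "real \<Rightarrow> real" where
  "gauss_curvature r = (h r * h'' r - 2 * (h' r)\<^sup>2) / (h r)\<^sup>2"

lemma partial_deriv_metric_h:
  assumes "p $ 1 \<in> S"
  shows "partial_deriv i (\<lambda>q. metric_h h q $ j $ k) p =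
    (if i = 1 \<and> j = 2 \<and> k = 2 then - 2 * h' (p $ 1) / (h (p $ 1)) ^ 3 else 0)"
proof (cases "j = 2 \<and> k = 2")
  case True
  have "((\<lambda>r. 1 / (h r)\<^sup>2) has_real_derivative - 2 * h' (p $ 1) / (h (p $ 1)) ^ 3) (at (p $ 1))"
    using h_nonzero[OF assms] h_deriv[OF assms]
    by (auto intro!: derivative_eq_intros simp: field_simps eval_nat_numeral)
  from partial_deriv_first_coordinate[OF open_S assms _ this] True show ?thesis
    by (simp add: metric_h_def)
next
  case False
  have "((\<lambda>r. if j = 1 \<and> k = 1 then 1 else 0) has_real_derivative 0) (at (p $ 1))"
    by simp
  from partial_deriv_first_coordinate[OF open_S assms _ this] False exhaust_2[of j] exhaust_2[of k]
  show ?thesis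
    by (auto simp: metric_h_def)
qed

lemma christoffel_metric_h:
  assumes "p $ 1 \<in> S"
  shows "christoffel (metric_h h) k i j p =
    (if k = 1 \<and> i = 2 \<and> j = 2 then h' (p $ 1) / (h (p $ 1)) ^ 3
     else if k = 2 \<and> i \<noteq> j then - h' (p $ 1) / h (p $ 1) else 0)"
  using exhaust_2[of k] exhaust_2[of i] exhaust_2[of j] h_nonzero[OF assms]
  unfolding christoffel_def
  by (auto simp: partial_deriv_metric_h[OF assms] matrix_inv_metric_h sum_2 eval_nat_numeral)

lemma partial_deriv_christoffel_metric_h:
  assumes "p $ 1 \<in> S"
  shows "partial_deriv m (christoffel (metric_h h) k i j) p =
    (if m = 1 \<and> k = 1 \<and> i = 2 \<and> j = 2
     then h'' (p $ 1) / (h (p $ 1)) ^ 3 - 3 * (h' (p $ 1))\<^sup>2 / (h (p $ 1)) ^ 4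
     else if m = 1 \<and> k = 2 \<and> i \<noteq> j
     then (h' (p $ 1))\<^sup>2 / (h (p $ 1))\<^sup>2 - h'' (p $ 1) / h (p $ 1) else 0)"
    (is "_ = (if _ then ?A else if _ then ?B else 0)")
proof -
  note nz = h_nonzero[OF assms] and ders = h_deriv[OF assms] h'_deriv[OF assms]
  have "((\<lambda>r. h' r / h r ^ 3) has_real_derivative ?A) (at (p $ 1))"
    using nz ders by (auto intro!: derivative_eq_intros simp: field_simps eval_nat_numeral)
  moreover have "((\<lambda>r. - h' r / h r) has_real_derivative ?B) (at (p $ 1))"
    using nz ders by (auto intro!: derivative_eq_intros simp: field_simps eval_nat_numeral)
  ultimately have "((\<lambda>r. if P then h' r / h r ^ 3 else if Q then - h' r / h r else 0)
      has_real_derivative (if P then ?A else if Q then ?B else 0)) (at (p $ 1))" for P Q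
    by (cases P; cases Q; simp)
  from partial_deriv_first_coordinate[OF open_S assms christoffel_metric_h this]
  show ?thesis by simp
qed

text \<open>
  The two zero cases are the two skew symmetries of the Riemann tensor: in \<open>i\<close>, \<open>j\<close>, and, after
  lowering \<open>l\<close> with the diagonal metric, in \<open>l\<close>, \<open>k\<close>. Up to sign the single remaining
  component is \<open>K det g = K/h\<^sup>2\<close>; the case \<open>l = 2\<close> lacks the factor \<open>1/h\<^sup>2\<close> because raising
  the index \<open>t\<close> multiplies by \<open>h\<^sup>2\<close>.
\<close>

lemma curvature_coeff_metric_h:
  assumes "p $ 1 \<in> S"
  shows "curvature_coeff (metric_h h) l i j k p =
    (if i = j \<or> l = k then 0
     else (if i = 1 then 1 else - 1) *
       (if l = 1 then gauss_curvature (p $ 1) / (h (p $ 1))\<^sup>2 else - gauss_curvature (p $ 1)))"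
  using exhaust_2[of i] exhaust_2[of j] exhaust_2[of k] exhaust_2[of l] h_nonzero[OF assms]
  unfolding curvature_coeff_def gauss_curvature_def
  by (elim disjE; simp add: christoffel_metric_h[OF assms] partial_deriv_christoffel_metric_h[OF assms] sum_2;
      simp add: field_simps eval_nat_numeral)

text \<open>
  In dimension two \<open>R(u, v)\<close> is skew in \<open>u\<close>, \<open>v\<close>, hence proportional to their determinant, and
  skew-adjoint, hence a multiple of the rotation by a right angle; the last vector is this rotation
  applied to \<open>w\<close>, up to a factor \<open>h\<close>.
\<close>

lemma curvature_tensor_metric_h:
  assumes "p $ 1 \<in> S"
  shows "curvature_tensor (metric_h h) p u v w =
    (gauss_curvature (p $ 1) * (u $ 1 * v $ 2 - u $ 2 * v $ 1)) *\<^sub>R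
      vector [w $ 2 / (h (p $ 1))\<^sup>2, - w $ 1]"
  by (simp add: curvature_tensor_def vec_eq_iff forall_2 sum_2 curvature_coeff_metric_h[OF assms])
     (simp add: algebra_simps diff_divide_distrib)

text \<open>
  Numerator and denominator are \<open>K d\<close> and \<open>d\<close>, where \<open>d\<close> is the squared area of the
  parallelogram spanned by \<open>u\<close> and \<open>v\<close>.
\<close>

theorem sectional_curvature_metric_h:
  assumes "p $ 1 \<in> S" "u $ 1 * v $ 2 - u $ 2 * v $ 1 \<noteq> 0"
  shows "sectional_curvature (metric_h h) p u v = gauss_curvature (p $ 1)"
proof -
  let ?d = "(u $ 1 * v $ 2 - u $ 2 * v $ 1)\<^sup>2 / (h (p $ 1))\<^sup>2"
  have "metric_inner (metric_h h) p (curvature_tensor (metric_h h) p u v v) u =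
      gauss_curvature (p $ 1) * ?d"
    using h_nonzero[OF assms(1)]
    by (simp add: curvature_tensor_metric_h[OF assms(1)] metric_inner_metric_h
        field_simps power2_eq_square)
  moreover have "metric_inner (metric_h h) p u u * metric_inner (metric_h h) p v v
      - (metric_inner (metric_h h) p u v)\<^sup>2 = ?d"
    using h_nonzero[OF assms(1)]
    by (simp add: metric_inner_metric_h field_simps power2_eq_square)
  moreover have "?d \<noteq> 0"
    using assms h_nonzero by simp
  ultimately show ?thesis
    unfolding sectional_curvature_def by simp
qed

text \<open>
  A nonzero \<open>X\<close> and \<open>J X\<close> span the tangent plane: their coordinate determinant is \<open>h \<bar>X\<bar>\<^sup>2\<close>, with
  the length taken in the metric.
\<close>

corollary holomorphic_sectional_curvature_metric_h:
  assumes "p $ 1 \<in> S" "X \<noteq> 0"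
  shows "holomorphic_sectional_curvature (metric_h h) (J_h h) p X = gauss_curvature (p $ 1)"
proof -
  note nz = h_nonzero[OF assms(1)]
  have "X $ 1 * J_h h p X $ 2 - X $ 2 * J_h h p X $ 1 =
      h (p $ 1) * metric_inner (metric_h h) p X X"
    using nz by (simp add: J_h_def T_h_def axis_def metric_inner_metric_h field_simps power2_eq_square)
  also have "\<dots> \<noteq> 0"
    using nz metric_h_pos_def[of h p X, OF nz assms(2)] by simp
  finally show ?thesis
    unfolding holomorphic_sectional_curvature_def
    by (rule sectional_curvature_metric_h[OF assms(1)])
qed

end

theorem proposition1p2:
  shows "(\<forall>p\<in>half_plane. \<forall>X. X \<noteq> 0 \<longrightarrow>
            holomorphic_sectional_curvature ds1 (J_h (\<lambda>r. 1 / r)) p X = 0) \<and>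
         (\<forall>p\<in>half_plane. \<forall>X. X \<noteq> 0 \<longrightarrow>
            holomorphic_sectional_curvature ds2 (J_h (\<lambda>r. r)) p X = - 2 / (p $ 1)\<^sup>2)"
proof (intro conjI ballI allI impI)
  fix p X :: "real ^ 2"
  assume p: "p \<in> half_plane" and X: "X \<noteq> 0"
  from p have r: "p $ 1 \<in> {0<..}" by (simp add: half_plane_def)
  interpret polar: nonvanishing_warping "{0<..}" "\<lambda>r. 1 / r" "\<lambda>r. - 1 / r\<^sup>2" "\<lambda>r. 2 / r ^ 3"
    by standard (auto intro!: derivative_eq_intros simp: field_simps eval_nat_numeral)
  have "polar.gauss_curvature (p $ 1) = 0"
    unfolding polar.gauss_curvature_def using r by (simp add: field_simps eval_nat_numeral)
  then show "holomorphic_sectional_curvature ds1 (J_h (\<lambda>r. 1 / r)) p X = 0"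
    unfolding ds1_eq_metric_h using polar.holomorphic_sectional_curvature_metric_h[OF r X] by simp
next
  fix p X :: "real ^ 2"
  assume p: "p \<in> half_plane" and X: "X \<noteq> 0"
  from p have r: "p $ 1 \<in> {0<..}" by (simp add: half_plane_def)
  interpret ident: nonvanishing_warping "{0<..}" "\<lambda>r. r" "\<lambda>r. 1" "\<lambda>r. 0"
    by standard auto
  show "holomorphic_sectional_curvature ds2 (J_h (\<lambda>r. r)) p X = - 2 / (p $ 1)\<^sup>2"
    using ident.holomorphic_sectional_curvature_metric_h[OF r X]
    by (simp add: ds2_eq_metric_h ident.gauss_curvature_def)
qed

end
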